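(* Let $f(x)=\phi(Ax)+g(x)$ be a non-smooth objective that can be smoothed (see context), $x_0\in\operatorname{dom} f$ and $K=\{x: f(x)\le f(x_0)\}$. Assume that we have access to a smoothing method $\mathcal{S}$ with the guarantee stated in the context, with constants $c$ and $L_{\psi^\star,A}$, for a given strongly convex function $h$, and that $f\in\mathcal{L}_{r,\mu,h}(K)$. Put $\kappa=L_{\psi^\star,A}^2/\mu^{2/r}$ and $\tau=1-1/r\in[0,1)$. Given $\epsilon_0\ge f(x_0)-f^*$, restart the method $\mathcal{S}$ such that for $k\ge1$, $$x_k=\mathcal{S}(x_{k-1},\epsilon_k,t_k),\qquad\epsilon_k=e^{-1}\epsilon_{k-1},\qquad t_k=\tilde C^*_{\kappa,\tau}e^{\tau k},\qquad\tilde C^*_{\kappa,\tau}=e^{1-\tau}(c\kappa)^{1/2}\epsilon_0^{-\tau}.$$ The precision reached at a point $\hat x=x_R$ after $R$ restarts is given by $$f(\hat x)-f^*\le\exp\left(-e^{-1}(c\kappa)^{-1/2}N\right)\epsilon_0=O\left(\exp(-\kappa^{-1/2}N)\right),\quad\text{when }\tau=0,$$ while $$f(\hat x)-f^*\le\frac{\epsilon_0}{\left(\tau e^{-1}(c\kappa)^{-1/2}\epsilon_0^{\tau}N+1\right)^{1/\tau}}=O\left(N^{-1/\tau}\right),\quad\text{when }\tau>0,$$ where $N=\sum_{k=1}^Rt_k$ is the total number of iterations.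
   Context: $A\in\mathbb{R}^{m\times n}$; $g$ is a simple convex function on $\mathbb{R}^n$ (problems $\min_z\{y^Tz+g(z)+\lambda D_h(z;x)\}$ can be solved in closed form or by a fast procedure); $\phi$ is a non-smooth convex function. "Can be smoothed" means: for some smooth convex function $\psi$ and any $\eta>0$ one has access to $\phi_{\eta\psi^\star}(x)=\sup_{u\in\operatorname{dom}\phi^\star}\{u^\top x-\phi^\star(u)-\eta\psi^\star(u)\}$, where $\star$ denotes the convex conjugate. $X^*$ is the set of minimizers of $f$ and $f^*$ its minimum. $\mu>0$, $r\ge1$ are constants. For $h$ differentiable and strongly convex with $\operatorname{dom} f\subset\operatorname{dom} h$, the Bregman divergence is $D_h(y;x)=h(y)-h(x)-\nabla h(x)^T(y-x)$, and $D_h(x,X^* )=\min_{x^*\in X^*}D_h(x^*;x)$. $\mathcal{L}_{r,\mu,h}(K)$ is the set of functions $f$ with $\frac{\mu}{r}D_h(x,X^* )^{r/2}\le f(x)-f^*$ for all $x\in K$ (relative Łojasiewicz growth condition). Guarantee of the smoothing method: from a starting point $x$, a target accuracy $\epsilon$ and a number of iterations $t$, $\mathcal{S}$ outputs $y=\mathcal{S}(x,\epsilon,t)$ such that $$f(y)-f^*\le\frac{\epsilon}{2}+\frac{cL_{\psi^\star,A}^2D_h(x,X^* )}{\epsilon^2t^2}\,\frac{\epsilon}{2}\qquad\text{and}\qquad f(y)\le f(x),$$ where $L_{\psi^\star,A}$ is a smoothing constant and $c$ is a constant ($c=32$ for the smoothing method based on the accelerated gradient algorithm). Iteration counts $t_k$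 are treated as real numbers (rounding to integers is ignored).
   Formalization: The c in the schedule and bounds must be at least r^(2/r) times the c of the guarantee of S (same c if r=1); with one c the claim fails, e.g. r=2. For τ=0 the O-term is exp(-aκ^(-1/2)N) with a=e^(-1)c^(-1/2), since a=1 fails for c=32. *)

theory Defs
  imports "HOL-Analysis.Analysis" "HOL-Library.Landau_Symbols"
begin

definition edom :: "('a \<Rightarrow> ereal) \<Rightarrow> 'a set" where
  "edom F = {x. F x < \<infinity>}"

definition proper_convex :: "('a::euclidean_space \<Rightarrow> ereal) \<Rightarrow> bool" where
  "proper_convex F \<longleftrightarrow>
     (\<forall>x. F x \<noteq> -\<infinity>) \<and> edom F \<noteq> {} \<and> convex {(x, a :: real). F x \<le> ereal a}"

definition conjugate :: "('a::euclidean_space \<Rightarrow> ereal) \<Rightarrow> 'a \<Rightarrow> ereal" where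
  "conjugate F u = (SUP x. ereal (u \<bullet> x) - F x)"

definition smooth_function :: "('a::euclidean_space \<Rightarrow> real) \<Rightarrow> bool" where
  "smooth_function \<psi> \<longleftrightarrow>
     (\<exists>G M. (\<forall>x. GDERIV \<psi> x :> G x) \<and> M-lipschitz_on UNIV G)"

definition smoothed ::
  "('a::euclidean_space \<Rightarrow> ereal) \<Rightarrow> ('a \<Rightarrow> real) \<Rightarrow> real \<Rightarrow> 'a \<Rightarrow> ereal" where
  "smoothed \<phi> \<psi> \<eta> x =
     (SUP u\<in>edom (conjugate \<phi>).
        ereal (u \<bullet> x) - conjugate \<phi> u - ereal \<eta> * conjugate (\<lambda>v. ereal (\<psi> v)) u)"

text \<open>Access to the smoothed function is a computational notion; what it presupposes
  is that the smoothed function is a real-valued function for every positive parameter.\<close>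

definition can_be_smoothed :: "('a::euclidean_space \<Rightarrow> ereal) \<Rightarrow> ('a \<Rightarrow> real) \<Rightarrow> bool" where
  "can_be_smoothed \<phi> \<psi> \<longleftrightarrow>
     convex_on UNIV \<psi> \<and> smooth_function \<psi> \<and>
     (\<forall>\<eta>>0. \<forall>x. \<bar>smoothed \<phi> \<psi> \<eta> x\<bar> \<noteq> \<infinity>)"

definition strongly_convex_on :: "'a::euclidean_space set \<Rightarrow> ('a \<Rightarrow> real) \<Rightarrow> bool" where
  "strongly_convex_on H h \<longleftrightarrow> convex H \<and>
     (\<exists>\<sigma>>0. \<forall>x\<in>H. \<forall>y\<in>H. \<forall>s\<in>{0..1}.
        h ((1 - s) *\<^sub>R x + s *\<^sub>R y)
          \<le> (1 - s) * h x + s * h y - \<sigma> / 2 * s * (1 - s) * (norm (x - y))\<^sup>2)"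

text \<open>A kernel is a real function \<open>h\<close> together with its domain \<open>H\<close>.  Derivatives are
  taken within \<open>H\<close>.  As \<open>H\<close> is convex, the derivative at a point \<open>x\<close> of \<open>H\<close> is
  determined in the directions \<open>y - x\<close> with \<open>y\<close> in \<open>H\<close>, even if \<open>x\<close> is not
  an interior point.\<close>

definition bregman ::
  "'a::euclidean_space set \<Rightarrow> ('a \<Rightarrow> real) \<Rightarrow> 'a \<Rightarrow> 'a \<Rightarrow> real" where
  "bregman H h y x = h y - h x - frechet_derivative h (at x within H) (y - x)"

definition bregman_kernel :: "'a::euclidean_space set \<Rightarrow> ('a \<Rightarrow> real) \<Rightarrow> bool" where
  "bregman_kernel H h \<longleftrightarrow> h differentiable_on H \<and> strongly_convex_on H h"

text \<open>For simplicity of \<open>g\<close>, only the solvability of the subproblems is kept,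
  not the cost of solving them.\<close>

definition bregman_simple ::
  "'a::euclidean_space set \<Rightarrow> ('a \<Rightarrow> real) \<Rightarrow> ('a \<Rightarrow> ereal) \<Rightarrow> bool" where
  "bregman_simple H h g \<longleftrightarrow>
     (\<forall>y. \<forall>l>0. \<forall>x\<in>H. \<exists>z\<in>H. \<forall>w\<in>H.
        ereal (y \<bullet> z) + g z + ereal (l * bregman H h z x)
          \<le> ereal (y \<bullet> w) + g w + ereal (l * bregman H h w x))"

definition argmins :: "('a \<Rightarrow> ereal) \<Rightarrow> 'a set" where
  "argmins f = {x. \<forall>y. f x \<le> f y}"

definition minval :: "('a \<Rightarrow> ereal) \<Rightarrow> ereal" where
  "minval f = (INF x. f x)"

text \<open>The infimum is the minimum whenever the latter exists.\<close>

definition bregman_dist ::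
  "'a::euclidean_space set \<Rightarrow> ('a \<Rightarrow> real) \<Rightarrow> 'a \<Rightarrow> 'a set \<Rightarrow> real" where
  "bregman_dist H h x X = (INF y\<in>X. bregman H h y x)"

definition lojasiewicz_class ::
  "real \<Rightarrow> real \<Rightarrow> 'a::euclidean_space set \<Rightarrow> ('a \<Rightarrow> real) \<Rightarrow> 'a set \<Rightarrow> ('a \<Rightarrow> ereal) set" where
  "lojasiewicz_class r \<mu> H h K =
     {f. \<forall>x\<in>K. ereal (\<mu> / r * bregman_dist H h x (argmins f) powr (r / 2)) \<le> f x - minval f}"

text \<open>\<open>S x \<epsilon> t\<close> is the output of the method for the starting point \<open>x\<close>, target accuracy
  \<open>\<epsilon>\<close> and (real) iteration count \<open>t\<close>.  The constant \<open>c\<close> below is the one of a single run.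
  Inverting the growth condition bounds the Bregman distance by
  \<open>r powr (2 / r) * ((f x - minval f) / \<mu>) powr (2 / r)\<close>; the factor \<open>r powr (2 / r)\<close> has
  to be part of the constant that is used in a restart schedule with
  \<open>\<kappa> = L\<^sup>2 / \<mu> powr (2 / r)\<close>.\<close>

definition smoothing_method ::
  "'a::euclidean_space set \<Rightarrow> ('a \<Rightarrow> real) \<Rightarrow> ('a \<Rightarrow> ereal) \<Rightarrow> real \<Rightarrow> real
     \<Rightarrow> ('a \<Rightarrow> real \<Rightarrow> real \<Rightarrow> 'a) \<Rightarrow> bool" where
  "smoothing_method H h f c L S \<longleftrightarrow>
     (\<forall>x\<in>edom f. \<forall>\<epsilon>>0. \<forall>t>0.
        f (S x \<epsilon> t) - minval f
          \<le> ereal (\<epsilon> / 2 + c * L\<^sup>2 * bregman_dist H h x (argmins f) / (\<epsilon>\<^sup>2 * t\<^sup>2) * (\<epsilon> / 2)) \<and>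
        f (S x \<epsilon> t) \<le> f x)"

end

theory Submission
  imports Defs
begin

text \<open>
  The gap satisfies \<open>f (x k) - f* \<le> \<epsilon> k = exp (- k) * \<epsilon> 0\<close> by induction: the growth condition
  turns the bound at \<open>x (k - 1)\<close> into a bound on the Bregman distance to the minimizers, and the
  schedule is chosen such that the factor multiplying \<open>\<epsilon> k / 2\<close> in the guarantee is then at most 1.
  It remains to express \<open>exp (- R)\<close> through \<open>N R\<close>, which is a linear function of \<open>R\<close> for
  \<open>\<tau> = 0\<close> and a geometric sum otherwise; in the latter case \<open>\<tau> \<le> exp \<tau> - 1\<close> loses a constant.
\<close>

text \<open>For positive \<open>D\<close> both sides are raised to the power \<open>2 / r\<close>.
  Otherwise the right-hand side is nonnegative anyway; the case split avoids having to know the sign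
  of an infimum of Bregman divergences.\<close>

lemma le_powr_inverse_of_growth:
  fixes D d r \<mu> :: real
  assumes "\<mu> > 0" "r > 0" and growth: "\<mu> / r * D powr (r / 2) \<le> d"
  shows "D \<le> (r * d / \<mu>) powr (2 / r)"
proof (cases "D > 0")
  case True
  have "D powr (r / 2) \<le> r * d / \<mu>"
    using assms by (simp add: field_simps)
  then have "(D powr (r / 2)) powr (2 / r) \<le> (r * d / \<mu>) powr (2 / r)"
    using assms by (intro powr_mono2) auto
  then show ?thesis
    using True assms by (simp add: powr_powr)
next
  case False
  then show ?thesis
    by (meson linorder_not_less order_trans powr_ge_zero)
qed

text \<open>Since \<open>exp 1 * e\<close> is the precision of the preceding restart and
  \<open>2 * (1 - \<tau>)\<close> will be \<open>2 / r\<close>, this is the equation that determines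
  the run length \<open>t\<close>. Both sides are positive, and after taking logarithms the claim is
  an identity that is linear in \<open>ln q\<close> and \<open>ln e0\<close>.\<close>

lemma restart_schedule_balanced:
  fixes q \<tau> e0 k :: real
  assumes "q > 0" "e0 > 0"
  defines "e \<equiv> exp (- k) * e0"
    and "t \<equiv> exp (1 - \<tau>) * q powr (1 / 2) * e0 powr (- \<tau>) * exp (\<tau> * k)"
  shows "q * (exp 1 * e) powr (2 * (1 - \<tau>)) = e\<^sup>2 * t\<^sup>2"
proof -
  have ln_e: "ln e = ln e0 - k" and ln_t: "ln t = 1 - \<tau> + ln q / 2 - \<tau> * ln e0 + \<tau> * k"
    using assms by (simp_all add: e_def t_def ln_mult ln_powr)
  have pos: "e > 0" "t > 0"
    using assms by (simp_all add: e_def t_def)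
  have "ln (q * (exp 1 * e) powr (2 * (1 - \<tau>))) = ln q + 2 * (1 - \<tau>) * (1 + ln e)"
    using assms pos by (simp add: ln_mult ln_powr)
  also have "\<dots> = 2 * ln e + 2 * ln t"
    unfolding ln_e ln_t by (simp add: algebra_simps)
  also have "\<dots> = ln (e\<^sup>2 * t\<^sup>2)"
    using pos by (simp add: ln_mult ln_realpow)
  finally show ?thesis
    using assms pos by simp
qed

lemma sum_exp_geometric:
  fixes \<tau> :: real
  shows "(exp \<tau> - 1) * (\<Sum>k = 1..R. exp (\<tau> * real k)) = exp \<tau> * (exp (\<tau> * real R) - 1)"
proof (induction R)
  case (Suc R)
  then show ?case
    by (simp add: algebra_simps exp_add)
qed simp

text \<open>The factor \<open>\<tau> * exp (- \<tau>)\<close> is what remains of the coefficient of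
  \<open>N R\<close> in the claimed rate once it is multiplied by \<open>C\<close>. With
  \<open>exp \<tau> - 1\<close> in place of \<open>\<tau>\<close> the geometric sum can be evaluated
  exactly.\<close>

lemma scaled_sum_exp_le:
  fixes \<tau> :: real
  assumes "\<tau> > 0"
  shows "\<tau> * exp (- \<tau>) * (\<Sum>k = 1..R. exp (\<tau> * real k)) \<le> exp (\<tau> * real R) - 1"
proof -
  have "\<tau> \<le> exp \<tau> - 1"
    using exp_ge_add_one_self[of \<tau>] by linarith
  then have "\<tau> * exp (- \<tau>) * (\<Sum>k = 1..R. exp (\<tau> * real k))
      \<le> (exp \<tau> - 1) * exp (- \<tau>) * (\<Sum>k = 1..R. exp (\<tau> * real k))"
    by (intro mult_right_mono sum_nonneg) auto
  also have "\<dots> = exp (- \<tau>) * ((exp \<tau> - 1) * (\<Sum>k = 1..R. exp (\<tau> * real k)))"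
    by (simp add: mult_ac)
  also have "\<dots> = exp (\<tau> * real R) - 1"
    unfolding sum_exp_geometric by (simp add: exp_minus)
  finally show ?thesis .
qed

text \<open>Dropping the summand 1 from the base leaves a pure power of \<open>n\<close>, with an
  explicit constant for the asymptotic claims.\<close>

lemma shifted_powr_decay_le:
  fixes a b n p :: real
  assumes "a > 0" "b \<ge> 0" "n > 0" "p > 0"
  shows "b / (a * n + 1) powr p \<le> b * a powr (- p) * n powr (- p)"
proof -
  have "a * n + 1 > 0"
    using assms by (simp add: add_pos_pos)
  then have "b / (a * n + 1) powr p \<le> b / (a * n) powr p"
    using assms by (intro divide_left_mono powr_mono2 mult_pos_pos) auto
  also have "\<dots> = b * a powr (- p) * n powr (- p)"
    using assms by (simp add: powr_mult powr_minus field_simps)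
  finally show ?thesis .
qed

lemma abs_real_of_ereal_le:
  assumes "0 \<le> a" "a \<le> ereal b"
  shows "\<bar>real_of_ereal a\<bar> \<le> b"
  using assms by (cases a) auto

lemma minval_le: "minval f \<le> f z"
  unfolding minval_def by (rule INF_lower) simp

lemma minval_eq_of_argmin:
  assumes "z \<in> argmins f"
  shows "minval f = f z"
  using assms by (intro antisym minval_le) (auto simp: minval_def argmins_def intro: INF_greatest)

text \<open>One restart: \<open>d\<close> bounds the gap before it and \<open>e\<close> is its
  target. The assumption \<open>balance\<close> makes the coefficient of the second
  \<open>e / 2\<close> in the guarantee at most 1, so that the two halves add up to at most
  \<open>e\<close>.\<close>

lemma smoothing_step:
  fixes f :: "'a::euclidean_space \<Rightarrow> ereal"
  assumes S: "smoothing_method H h f c0 L S" and "f \<in> lojasiewicz_class r \<mu> H h K"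
    and "y \<in> edom f" "y \<in> K" and gap: "f y - minval f \<le> ereal d"
    and pos: "c0 > 0" "\<mu> > 0" "r > 0" "d > 0" "e > 0" "t > 0"
    and balance: "r powr (2 / r) * c0 * (L\<^sup>2 / \<mu> powr (2 / r)) * d powr (2 / r) \<le> e\<^sup>2 * t\<^sup>2"
  shows "f (S y e t) - minval f \<le> ereal e" "f (S y e t) \<le> f y"
proof -
  define D where "D = bregman_dist H h y (argmins f)"
  have guarantee: "f (S y e t) - minval f \<le> ereal (e / 2 + c0 * L\<^sup>2 * D / (e\<^sup>2 * t\<^sup>2) * (e / 2))"
    and "f (S y e t) \<le> f y"
    using S assms(3) pos by (auto simp: smoothing_method_def D_def)
  then show "f (S y e t) \<le> f y"
    by simp
  have "ereal (\<mu> / r * D powr (r / 2)) \<le> f y - minval f"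
    using assms(2,4) by (simp add: lojasiewicz_class_def D_def)
  also note gap
  finally have "D \<le> (r * d / \<mu>) powr (2 / r)"
    using pos by (intro le_powr_inverse_of_growth) auto
  then have "c0 * L\<^sup>2 * D \<le> c0 * L\<^sup>2 * (r * d / \<mu>) powr (2 / r)"
    using pos by (intro mult_left_mono) auto
  also have "\<dots> = r powr (2 / r) * c0 * (L\<^sup>2 / \<mu> powr (2 / r)) * d powr (2 / r)"
    using pos by (simp add: powr_mult powr_divide)
  also note balance
  finally have "c0 * L\<^sup>2 * D / (e\<^sup>2 * t\<^sup>2) \<le> 1"
    using pos by simp
  then have "c0 * L\<^sup>2 * D / (e\<^sup>2 * t\<^sup>2) * (e / 2) \<le> 1 * (e / 2)"
    using pos by (intro mult_right_mono) auto
  then have "e / 2 + c0 * L\<^sup>2 * D / (e\<^sup>2 * t\<^sup>2) * (e / 2) \<le> e"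
    by linarith
  with guarantee show "f (S y e t) - minval f \<le> ereal e"
    by (meson ereal_less_eq(3) order_trans)
qed

text \<open>Each rate comes in three forms: a bound after every number of restarts, the order of
  that bound in a real iteration count, and the order of the gap itself along the restarts. For
  \<open>\<tau> = 0\<close> the factor with \<open>c\<close> stays in the exponent, where a Landau
  symbol cannot absorb it.\<close>

theorem proposition5p5:
  fixes \<phi> :: "real ^ 'm \<Rightarrow> ereal" and \<psi> :: "real ^ 'm \<Rightarrow> real"
    and g f :: "real ^ 'n \<Rightarrow> ereal" and A :: "real ^ 'n ^ 'm"
    and H K :: "(real ^ 'n) set" and h :: "real ^ 'n \<Rightarrow> real"
    and S :: "real ^ 'n \<Rightarrow> real \<Rightarrow> real \<Rightarrow> real ^ 'n"
    and \<mu> r c c0 L \<kappa> \<tau> C :: real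
    and x :: "nat \<Rightarrow> real ^ 'n" and \<epsilon> t N :: "nat \<Rightarrow> real"
  assumes "proper_convex \<phi>" and "proper_convex g"
    and "f = (\<lambda>z. \<phi> (A *v z) + g z)"
    and "can_be_smoothed \<phi> \<psi>"
    and "bregman_kernel H h" and "edom f \<subseteq> H" and "bregman_simple H h g"
    and "argmins f \<noteq> {}"
    and "x 0 \<in> edom f" and "K = {z. f z \<le> f (x 0)}"
    and "c0 > 0" and "L > 0" and "smoothing_method H h f c0 L S"
    and "\<mu> > 0" and "r \<ge> 1" and "f \<in> lojasiewicz_class r \<mu> H h K"
    and "c \<ge> r powr (2 / r) * c0"
    and "\<kappa> = L\<^sup>2 / \<mu> powr (2 / r)" and "\<tau> = 1 - 1 / r"
    and "\<epsilon> 0 > 0" and "ereal (\<epsilon> 0) \<ge> f (x 0) - minval f"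
    and "C = exp (1 - \<tau>) * (c * \<kappa>) powr (1 / 2) * \<epsilon> 0 powr (- \<tau>)"
    and "\<And>k. k \<ge> 1 \<Longrightarrow> x k = S (x (k - 1)) (\<epsilon> k) (t k)"
    and "\<And>k. k \<ge> 1 \<Longrightarrow> \<epsilon> k = exp (- 1) * \<epsilon> (k - 1)"
    and "\<And>k. k \<ge> 1 \<Longrightarrow> t k = C * exp (\<tau> * real k)"
    and "\<And>R. N R = (\<Sum>k = 1..R. t k)"
  shows
    "(\<tau> = 0 \<longrightarrow>
       (\<forall>R. f (x R) - minval f
              \<le> ereal (exp (- exp (- 1) * (c * \<kappa>) powr (- (1 / 2)) * N R) * \<epsilon> 0)) \<and>
       (\<lambda>n. exp (- exp (- 1) * (c * \<kappa>) powr (- (1 / 2)) * n) * \<epsilon> 0)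
         \<in> O[at_top](\<lambda>n. exp (- (exp (- 1) * c powr (- (1 / 2))) * (\<kappa> powr (- (1 / 2)) * n))) \<and>
       (\<lambda>R. real_of_ereal (f (x R) - minval f))
         \<in> O(\<lambda>R. exp (- (exp (- 1) * c powr (- (1 / 2))) * (\<kappa> powr (- (1 / 2)) * N R)))) \<and>
     (\<tau> > 0 \<longrightarrow>
       (\<forall>R. f (x R) - minval f
              \<le> ereal (\<epsilon> 0 / (\<tau> * exp (- 1) * (c * \<kappa>) powr (- (1 / 2)) * \<epsilon> 0 powr \<tau> * N R + 1)
                              powr (1 / \<tau>))) \<and>
       (\<lambda>n. \<epsilon> 0 / (\<tau> * exp (- 1) * (c * \<kappa>) powr (- (1 / 2)) * \<epsilon> 0 powr \<tau> * n + 1)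
                       powr (1 / \<tau>))
         \<in> O[at_top](\<lambda>n. n powr (- (1 / \<tau>))) \<and>
       (\<lambda>R. real_of_ereal (f (x R) - minval f)) \<in> O(\<lambda>R. N R powr (- (1 / \<tau>))))"
proof -
  note f_def = assms(3) and x0 = assms(9) and K_def = assms(10)
    and \<kappa>_def = assms(18) and \<tau>_def = assms(19) and C_def = assms(22)
    and x_step = assms(23) and \<epsilon>_step = assms(24) and t_def = assms(25) and N_def = assms(26)
  define q where "q = c * \<kappa>"
  define e0 where "e0 = \<epsilon> 0"
  have "r powr (2 / r) * c0 > 0"
    using \<open>c0 > 0\<close> \<open>r \<ge> 1\<close> by simp
  then have "c > 0"
    using \<open>c \<ge> r powr (2 / r) * c0\<close> by linarith
  have "\<kappa> > 0"
    using \<open>L > 0\<close> \<open>\<mu> > 0\<close> by (simp add: \<kappa>_def)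
  have "q > 0"
    using \<open>c > 0\<close> \<open>\<kappa> > 0\<close> by (simp add: q_def)
  have "e0 > 0"
    using \<open>\<epsilon> 0 > 0\<close> by (simp add: e0_def)
  have C_eq: "C = exp (1 - \<tau>) * q powr (1 / 2) * e0 powr (- \<tau>)"
    by (simp add: C_def q_def e0_def)
  have "C > 0"
    using \<open>q > 0\<close> \<open>e0 > 0\<close> by (simp add: C_eq)
  have r_eq: "2 / r = 2 * (1 - \<tau>)"
    by (simp add: \<tau>_def)
  have \<epsilon>_eq: "\<epsilon> k = exp (- real k) * e0" for k
  proof (induction k)
    case (Suc k)
    then show ?case
      using \<epsilon>_step[of "Suc k"] by (simp add: exp_add[symmetric] mult.assoc[symmetric])
  qed (simp add: e0_def)

  \<comment> \<open>The minimum is finite: properness of \<open>\<phi>\<close> and \<open>g\<close>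
    excludes minus infinity, and \<open>x 0\<close> in the domain excludes plus infinity.\<close>
  obtain z where "z \<in> argmins f"
    using \<open>argmins f \<noteq> {}\<close> by auto
  then have "minval f = f z"
    by (rule minval_eq_of_argmin)
  moreover have "f z \<noteq> - \<infinity>"
    using assms(1,2) by (simp add: f_def proper_convex_def)
  moreover have "f z < \<infinity>"
    using x0 minval_le[of f "x 0"] \<open>minval f = f z\<close> by (auto simp: edom_def)
  ultimately have gap_nonneg: "0 \<le> f y - minval f" for y
    using minval_le[of f y] by (cases "f y"; cases "f z") auto

  \<comment> \<open>The descent part keeps every iterate in \<open>K\<close> and in the domain of
    \<open>f\<close>, where the growth condition and the guarantee apply.\<close>
  have gap_and_descent: "f (x R) - minval f \<le> ereal (\<epsilon> R) \<and> f (x R) \<le> f (x 0)" for R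
  proof (induction R)
    case 0
    then show ?case
      using assms(21) by simp
  next
    case (Suc R)
    let ?k = "Suc R"
    have edom: "x R \<in> edom f" and "x R \<in> K"
      using Suc x0 by (auto simp: edom_def K_def)
    have "r powr (2 / r) * c0 * (L\<^sup>2 / \<mu> powr (2 / r)) * \<epsilon> R powr (2 / r)
        \<le> c * (L\<^sup>2 / \<mu> powr (2 / r)) * \<epsilon> R powr (2 / r)"
      using \<open>c \<ge> r powr (2 / r) * c0\<close> by (intro mult_right_mono) auto
    \<comment> \<open>The old precision \<open>\<epsilon> R\<close> is written as
      \<open>exp 1\<close> times the new one, as the schedule lemma expects.\<close>
    also have "\<dots> = q * (exp 1 * (exp (- real ?k) * e0)) powr (2 * (1 - \<tau>))"
      unfolding \<kappa>_def r_eq q_def \<epsilon>_eq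
      by (simp add: mult.assoc[symmetric] exp_add[symmetric])
    also have "\<dots> = (\<epsilon> ?k)\<^sup>2 * (t ?k)\<^sup>2"
      using restart_schedule_balanced[OF \<open>q > 0\<close> \<open>e0 > 0\<close>, of "real ?k" \<tau>]
      by (simp add: \<epsilon>_eq t_def C_eq)
    finally have balance: "r powr (2 / r) * c0 * (L\<^sup>2 / \<mu> powr (2 / r)) * \<epsilon> R powr (2 / r)
        \<le> (\<epsilon> ?k)\<^sup>2 * (t ?k)\<^sup>2" .
    have pos: "\<epsilon> R > 0" "\<epsilon> ?k > 0" "t ?k > 0" "r > 0"
      using \<open>e0 > 0\<close> \<open>C > 0\<close> \<open>r \<ge> 1\<close> by (simp_all add: \<epsilon>_eq t_def)
    note step = smoothing_step[OF assms(13,16) edom \<open>x R \<in> K\<close> conjunct1[OF Suc] \<open>c0 > 0\<close> \<open>\<mu> > 0\<close>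
        pos(4,1,2,3) balance]
    have "x ?k = S (x R) (\<epsilon> ?k) (t ?k)"
      using x_step[of ?k] by simp
    then show ?case
      using step Suc by auto
  qed
  have gap: "f (x R) - minval f \<le> ereal (exp (- real R) * e0)" for R
    using gap_and_descent[of R] by (simp add: \<epsilon>_eq)
  have N_eq: "N R = C * (\<Sum>k = 1..R. exp (\<tau> * real k))" for R
    by (simp add: N_def t_def sum_distrib_left)
  have q_cancel: "q powr (- (1 / 2)) * q powr (1 / 2) = 1"
    using \<open>q > 0\<close> by (simp add: powr_add[symmetric])

  show ?thesis
    unfolding q_def[symmetric] e0_def[symmetric]
  proof (intro conjI impI)
    assume "\<tau> = 0"
    have rate: "exp (- exp (- 1) * q powr (- (1 / 2)) * n) * e0
        = e0 * exp (- (exp (- 1) * c powr (- (1 / 2))) * (\<kappa> powr (- (1 / 2)) * n))" for n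
      using \<open>c > 0\<close> \<open>\<kappa> > 0\<close> by (simp add: q_def powr_mult mult_ac)
    \<comment> \<open>For \<open>\<tau> = 0\<close> all runs have the same length
      \<open>C = exp 1 * q powr (1 / 2)\<close>, so \<open>N R\<close> is \<open>R\<close> times
      this length.\<close>
    have "exp (- 1) * q powr (- (1 / 2)) * N R = real R" for R
    proof -
      have "exp (- 1) * q powr (- (1 / 2)) * N R
          = (exp (- 1) * exp 1) * (q powr (- (1 / 2)) * q powr (1 / 2)) * real R"
        using \<open>\<tau> = 0\<close> \<open>e0 > 0\<close> by (simp add: N_eq C_eq)
      then show ?thesis
        unfolding q_cancel by (simp add: exp_add[symmetric])
    qed
    then have gap_N: "f (x R) - minval f \<le> ereal (exp (- exp (- 1) * q powr (- (1 / 2)) * N R) * e0)" for R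
      using gap[of R] by simp
    then show "\<forall>R. f (x R) - minval f \<le> ereal (exp (- exp (- 1) * q powr (- (1 / 2)) * N R) * e0)"
      by blast
    show "(\<lambda>n. exp (- exp (- 1) * q powr (- (1 / 2)) * n) * e0)
        \<in> O[at_top](\<lambda>n. exp (- (exp (- 1) * c powr (- (1 / 2))) * (\<kappa> powr (- (1 / 2)) * n)))"
      unfolding rate by simp
    show "(\<lambda>R. real_of_ereal (f (x R) - minval f))
        \<in> O(\<lambda>R. exp (- (exp (- 1) * c powr (- (1 / 2))) * (\<kappa> powr (- (1 / 2)) * N R)))"
      using abs_real_of_ereal_le[OF gap_nonneg gap_N] unfolding rate
      by (intro bigoI[where c = e0]) simp
  next
    assume "\<tau> > 0"
    define a where "a = \<tau> * exp (- 1) * q powr (- (1 / 2)) * e0 powr \<tau>"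
    have "a > 0"
      using \<open>\<tau> > 0\<close> \<open>q > 0\<close> \<open>e0 > 0\<close> by (simp add: a_def)
    have N_nonneg: "N R \<ge> 0" for R
      using \<open>C > 0\<close> by (simp add: N_eq sum_nonneg)
    \<comment> \<open>The powers of \<open>q\<close> and \<open>e0\<close> cancel, and
      \<open>exp (- 1) * exp (1 - \<tau>)\<close> leaves \<open>exp (- \<tau>)\<close>.\<close>
    have aC: "a * C = \<tau> * exp (- \<tau>)"
    proof -
      have "a * C = \<tau> * (exp (- 1) * exp (1 - \<tau>)) * (q powr (- (1 / 2)) * q powr (1 / 2))
          * (e0 powr \<tau> * e0 powr (- \<tau>))"
        by (simp add: a_def C_eq mult_ac)
      then show ?thesis
        unfolding q_cancel using \<open>e0 > 0\<close> by (simp add: exp_add[symmetric] powr_add[symmetric])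
    qed
    have gap_N: "f (x R) - minval f \<le> ereal (e0 / (a * N R + 1) powr (1 / \<tau>))" for R
    proof -
      have "a * N R + 1 \<le> exp (\<tau> * real R)"
        using scaled_sum_exp_le[OF \<open>\<tau> > 0\<close>, of R]
        by (simp add: N_eq mult.assoc[symmetric] aC)
      then have "(a * N R + 1) powr (1 / \<tau>) \<le> exp (\<tau> * real R) powr (1 / \<tau>)"
        using \<open>\<tau> > 0\<close> \<open>a > 0\<close> N_nonneg[of R] by (intro powr_mono2) auto
      also have "\<dots> = exp (real R)"
        using \<open>\<tau> > 0\<close> by (simp add: powr_def)
      finally have "e0 / exp (real R) \<le> e0 / (a * N R + 1) powr (1 / \<tau>)"
        using \<open>e0 > 0\<close> \<open>a > 0\<close> N_nonneg[of R]
        by (intro divide_left_mono mult_pos_pos) (auto simp: add_nonneg_eq_0_iff)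
      moreover have "e0 / exp (real R) = exp (- real R) * e0"
        by (simp add: exp_minus field_simps)
      ultimately show ?thesis
        using gap[of R] by (metis ereal_less_eq(3) order_trans)
    qed
    then show "\<forall>R. f (x R) - minval f
        \<le> ereal (e0 / (\<tau> * exp (- 1) * q powr (- (1 / 2)) * e0 powr \<tau> * N R + 1) powr (1 / \<tau>))"
      by (simp add: a_def)
    have decay: "e0 / (a * n + 1) powr (1 / \<tau>) \<le> e0 * a powr (- (1 / \<tau>)) * n powr (- (1 / \<tau>))"
      if "n > 0" for n
      using shifted_powr_decay_le[of a e0 n "1 / \<tau>"] \<open>a > 0\<close> \<open>e0 > 0\<close> \<open>\<tau> > 0\<close> that by simp
    have "(\<lambda>n. e0 / (a * n + 1) powr (1 / \<tau>)) \<in> O[at_top](\<lambda>n. n powr (- (1 / \<tau>)))"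
    proof (rule bigoI)
      show "\<forall>\<^sub>F n in at_top. norm (e0 / (a * n + 1) powr (1 / \<tau>))
          \<le> e0 * a powr (- (1 / \<tau>)) * norm (n powr (- (1 / \<tau>)))"
        using eventually_gt_at_top[of 0] by eventually_elim (use decay \<open>e0 > 0\<close> in simp)
    qed
    then show "(\<lambda>n. e0 / (\<tau> * exp (- 1) * q powr (- (1 / 2)) * e0 powr \<tau> * n + 1) powr (1 / \<tau>))
        \<in> O[at_top](\<lambda>n. n powr (- (1 / \<tau>)))"
      by (simp add: a_def)
    show "(\<lambda>R. real_of_ereal (f (x R) - minval f)) \<in> O(\<lambda>R. N R powr (- (1 / \<tau>)))"
    proof (rule bigoI)
      show "\<forall>\<^sub>F R in sequentially. norm (real_of_ereal (f (x R) - minval f))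
          \<le> e0 * a powr (- (1 / \<tau>)) * norm (N R powr (- (1 / \<tau>)))"
        \<comment> \<open>\<open>R = 0\<close> has to be excluded: there \<open>N R = 0\<close>, and
          \<open>0 powr (- (1 / \<tau>))\<close> is 0 by convention.\<close>
        using eventually_gt_at_top[of 0]
      proof eventually_elim
        case (elim R)
        then have "N R > 0"
          using \<open>C > 0\<close> by (auto simp: N_eq intro!: mult_pos_pos sum_pos)
        then show ?case
          using abs_real_of_ereal_le[OF gap_nonneg gap_N, of R] decay[of "N R"] by simp
      qed
    qed
  qed
qed

end
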